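(* Let $V$ and $W$ be binomial varieties of $\mathbb{P}^n$. Assume that $V$ and $W$ have the same binomial exponents. In addition, suppose that $V$ or $W$ contains a point $p = [p_0:\cdots:p_n]$ with $p_0\cdots p_n \neq 0$. Then $V \star W$ is also a binomial variety that has the same binomial exponents as $V$ and $W$. More precisely, if $$\mathbb{I}(V) = \langle a_1X^{\alpha_1} -b_1X^{\beta_1},\ldots, a_sX^{\alpha_s}-b_sX^{\beta_s} \rangle$$ and $$\mathbb{I}(W) = \langle c_1X^{\alpha_1} -d_1X^{\beta_1},\ldots, c_sX^{\alpha_s}-d_sX^{\beta_s} \rangle$$ are generating sets exhibiting that $V$ and $W$ have the same binomial exponents (so all $a_i,b_i,c_i,d_i\in k$ are nonzero), then $$\mathbb{I}(V\star W) = \langle a_1c_1X^{\alpha_1} -b_1d_1X^{\beta_1}, a_2c_2X^{\alpha_2} - b_2d_2X^{\beta_2},\ldots, a_sc_sX^{\alpha_s}-b_sd_sX^{\beta_s} \rangle.$$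
   Context: $k$ is an algebraically closed field of characteristic zero, $\mathbb{P}^n$ is projective $n$-space over $k$, and $R = k[x_0,\ldots,x_n]$ has the standard grading. Projective varieties are Zariski closed subsets of $\mathbb{P}^n$ and need not be irreducible; $\mathbb{I}(X) \subseteq R$ denotes the homogeneous vanishing ideal of $X$. For $\alpha = (\alpha_0,\ldots,\alpha_n) \in \mathbb{N}^{n+1}$, $X^\alpha := x_0^{\alpha_0}\cdots x_n^{\alpha_n}$. Hadamard product: for points $p=[p_0:\cdots:p_n]$, $q=[q_0:\cdots:q_n]$, $p\star q := [p_0q_0:\cdots:p_nq_n]$, which is defined when $p_iq_i \neq 0$ for at least one $i$. For projective varieties $X,Y \subseteq \mathbb{P}^n$, $X \star Y$ is the Zariski closure of $\{p\star q \mid p \in X, q\in Y, p\star q \text{ is defined}\}$ in $\mathbb{P}^n$. A binomial is a polynomial with exactly two terms, $a_1X^{\alpha_1}-a_2X^{\alpha_2}$ with $a_1,a_2 \in k\setminus\{0\}$ and $\alpha_1\neq\alpha_2$; it is homogeneous if both monomials have the same degree. A projective variety $V \subseteq \mathbb{P}^n$ is a binomial variety if $\mathbb{I}(V)$ is generated by homogeneous binomials. Two binomial varieties $V$ and $W$ have the same binomial exponents if there are ordered lists $\alpha_1,\ldots,\alpha_s$ and $\beta_1,\ldots,\beta_s$ in $\mathbb{N}^{n+1}$, with $\alpha_i \neq \beta_i$ for all $i$ and the pairs $(\alpha_i,\beta_i)$ pairwise distinct, and nonzero constants $a_i,b_i,c_i,d_i \in k$ ($i=1,\ldots,s$) such that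 $\mathbb{I}(V) = \langle a_1X^{\alpha_1}-b_1X^{\beta_1},\ldots,a_sX^{\alpha_s}-b_sX^{\beta_s}\rangle$ and $\mathbb{I}(W) = \langle c_1X^{\alpha_1}-d_1X^{\beta_1},\ldots,c_sX^{\alpha_s}-d_sX^{\beta_s}\rangle$. *)

theory Defs
  imports
    Complex_Main
    "HOL-Library.Poly_Mapping"
    "HOL-Computational_Algebra.Polynomial"
begin

text \<open>
  The coordinates are indexed by a finite type \<open>'n\<close>, so that \<open>'n\<close> has \<open>n + 1\<close> elements for
  projective \<open>n\<close>-space. The polynomial ring in the corresponding variables is the monoid ring of
  the exponent vectors.
\<close>

type_synonym 'n monom = "'n \<Rightarrow>\<^sub>0 nat"
type_synonym ('k, 'n) mpoly = "('n \<Rightarrow>\<^sub>0 nat) \<Rightarrow>\<^sub>0 'k"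

definition monom_degree :: "'n::finite monom \<Rightarrow> nat"
  where "monom_degree m = (\<Sum>i\<in>UNIV. Poly_Mapping.lookup m i)"

definition eval_mpoly :: "('k::field, 'n::finite) mpoly \<Rightarrow> ('n \<Rightarrow> 'k) \<Rightarrow> 'k"
  where "eval_mpoly f v =
    (\<Sum>m\<in>Poly_Mapping.keys f.
      Poly_Mapping.lookup f m * (\<Prod>i\<in>UNIV. v i ^ Poly_Mapping.lookup m i))"

text \<open>The zero polynomial counts as homogeneous.\<close>

definition homogeneous :: "('k::field, 'n::finite) mpoly \<Rightarrow> bool"
  where "homogeneous f \<longleftrightarrow> (\<exists>d. \<forall>m\<in>Poly_Mapping.keys f. monom_degree m = d)"

lemma module_times: "module ((*) :: 'a::comm_ring_1 \<Rightarrow> 'a \<Rightarrow> 'a)"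
  by unfold_locales (simp_all add: algebra_simps)

text \<open>An ideal is a submodule of the ring.\<close>

definition ideal_of :: "'a::comm_ring_1 set \<Rightarrow> 'a set"
  where "ideal_of B = module.span (*) B"

definition proj_rel :: "('n \<Rightarrow> 'k::field) \<Rightarrow> ('n \<Rightarrow> 'k) \<Rightarrow> bool"
  where "proj_rel u v \<longleftrightarrow> (\<exists>i. u i \<noteq> 0) \<and> (\<exists>c. c \<noteq> 0 \<and> v = (\<lambda>i. c * u i))"

lemma proj_rel_refl: "(\<exists>i. u i \<noteq> 0) \<Longrightarrow> proj_rel u u"
  unfolding proj_rel_def by (intro conjI exI[of _ 1]) auto

lemma proj_rel_sym: "proj_rel u v \<Longrightarrow> proj_rel v u"
proof -
  assume "proj_rel u v"
  then obtain c i where c: "c \<noteq> 0" "v = (\<lambda>i. c * u i)" "u i \<noteq> 0"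
    by (auto simp: proj_rel_def)
  then have "v i \<noteq> 0" "u = (\<lambda>i. inverse c * v i)" "inverse c \<noteq> 0"
    by (simp_all add: mult.assoc[symmetric])
  then show "proj_rel v u"
    unfolding proj_rel_def by blast
qed

lemma proj_rel_trans: "proj_rel u v \<Longrightarrow> proj_rel v w \<Longrightarrow> proj_rel u w"
proof -
  assume "proj_rel u v" "proj_rel v w"
  then obtain c d where "c \<noteq> 0" "v = (\<lambda>i. c * u i)" "\<exists>i. u i \<noteq> 0" "d \<noteq> 0" "w = (\<lambda>i. d * v i)"
    unfolding proj_rel_def by blast
  then have "d * c \<noteq> 0" "w = (\<lambda>i. (d * c) * u i)" "\<exists>i. u i \<noteq> 0"
    by (simp_all add: mult.assoc)
  then show "proj_rel u w"
    unfolding proj_rel_def by blast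
qed

quotient_type (overloaded) ('k, 'n) proj_space = "'n \<Rightarrow> 'k::field" / partial: proj_rel
proof (rule part_equivpI)
  show "\<exists>u :: 'n \<Rightarrow> 'k. proj_rel u u"
    by (intro exI[of _ "\<lambda>_. 1"] proj_rel_refl) simp
  show "symp (proj_rel :: ('n \<Rightarrow> 'k) \<Rightarrow> _)"
    by (rule sympI) (rule proj_rel_sym)
  show "transp (proj_rel :: ('n \<Rightarrow> 'k) \<Rightarrow> _)"
    by (rule transpI) (rule proj_rel_trans)
qed

lift_definition homogeneous_coords :: "('k::field, 'n) proj_space \<Rightarrow> ('n \<Rightarrow> 'k) set"
  is "\<lambda>u. {v. proj_rel u v}"
proof -
  fix u u' :: "'n \<Rightarrow> 'k"
  assume u: "proj_rel u u'"
  show "{v. proj_rel u v} = {v. proj_rel u' v}"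
    using proj_rel_trans[OF u] proj_rel_trans[OF proj_rel_sym[OF u]] by blast
qed

text \<open>Used only for homogeneous \<open>f\<close>, where one coordinate vector decides it.\<close>

definition vanishes_at :: "('k::field, 'n::finite) mpoly \<Rightarrow> ('k, 'n) proj_space \<Rightarrow> bool"
  where "vanishes_at f p \<longleftrightarrow> (\<forall>v\<in>homogeneous_coords p. eval_mpoly f v = 0)"

definition zariski_closed :: "('k::field, 'n::finite) proj_space set \<Rightarrow> bool"
  where "zariski_closed X \<longleftrightarrow>
    (\<exists>F. (\<forall>f\<in>F. homogeneous f) \<and> X = {p. \<forall>f\<in>F. vanishes_at f p})"

definition zariski_closure ::
    "('k::field, 'n::finite) proj_space set \<Rightarrow> ('k, 'n) proj_space set"
  where "zariski_closure X = \<Inter> {Z. zariski_closed Z \<and> X \<subseteq> Z}"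

definition vanishing_ideal :: "('k::field, 'n::finite) proj_space set \<Rightarrow> ('k, 'n) mpoly set"
  where "vanishing_ideal X = ideal_of {f. homogeneous f \<and> (\<forall>p\<in>X. vanishes_at f p)}"

lift_definition all_coords_nonzero :: "('k::field, 'n) proj_space \<Rightarrow> bool"
  is "\<lambda>u. \<forall>i. u i \<noteq> 0"
proof -
  fix u u' :: "'n \<Rightarrow> 'k"
  assume "proj_rel u u'"
  then obtain c where "c \<noteq> 0" "u' = (\<lambda>i. c * u i)"
    unfolding proj_rel_def by blast
  then show "(\<forall>i. u i \<noteq> 0) = (\<forall>i. u' i \<noteq> 0)"
    by simp
qed

lift_definition hadamard_defined ::
    "('k::field, 'n) proj_space \<Rightarrow> ('k, 'n) proj_space \<Rightarrow> bool"
  is "\<lambda>u v. \<exists>i. u i * v i \<noteq> 0"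
proof -
  fix u u' v v' :: "'n \<Rightarrow> 'k"
  assume "proj_rel u u'" "proj_rel v v'"
  then obtain c d where "c \<noteq> 0" "u' = (\<lambda>i. c * u i)" "d \<noteq> 0" "v' = (\<lambda>i. d * v i)"
    unfolding proj_rel_def by blast
  then show "(\<exists>i. u i * v i \<noteq> 0) = (\<exists>i. u' i * v' i \<noteq> 0)"
    by simp
qed

text \<open>The value is meaningful only if \<^const>\<open>hadamard_defined\<close> holds.\<close>

lift_definition hadamard_point ::
    "('k::field, 'n) proj_space \<Rightarrow> ('k, 'n) proj_space \<Rightarrow> ('k, 'n) proj_space"
  is "\<lambda>u v. if \<exists>i. u i * v i \<noteq> 0 then (\<lambda>i. u i * v i) else (\<lambda>_. 1)"
proof -
  fix u u' v v' :: "'n \<Rightarrow> 'k"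
  assume "proj_rel u u'" "proj_rel v v'"
  then obtain c d where cd: "c \<noteq> 0" "u' = (\<lambda>i. c * u i)" "d \<noteq> 0" "v' = (\<lambda>i. d * v i)"
    unfolding proj_rel_def by blast
  have eq: "(\<lambda>i. u' i * v' i) = (\<lambda>i. (c * d) * (u i * v i))"
    using cd(2,4) by (simp add: mult_ac)
  show "proj_rel (if \<exists>i. u i * v i \<noteq> 0 then (\<lambda>i. u i * v i) else (\<lambda>_. 1))
      (if \<exists>i. u' i * v' i \<noteq> 0 then (\<lambda>i. u' i * v' i) else (\<lambda>_. 1))"
  proof (cases "\<exists>i. u i * v i \<noteq> 0")
    case True
    then have "\<exists>i. u' i * v' i \<noteq> 0"
      using cd(1,3) by (simp add: cd(2,4))
    moreover have "proj_rel (\<lambda>i. u i * v i) (\<lambda>i. u' i * v' i)"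
      unfolding proj_rel_def
      by (rule conjI[OF True], rule exI[of _ "c * d"], rule conjI[OF _ eq])
        (simp add: cd(1,3))
    ultimately show ?thesis
      using True by simp
  next
    case False
    then have "\<not> (\<exists>i. u' i * v' i \<noteq> 0)"
      by (auto simp add: cd(2,4))
    moreover have "proj_rel (\<lambda>_ :: 'n. 1 :: 'k) (\<lambda>_. 1)"
      by (rule proj_rel_refl) simp
    ultimately show ?thesis
      using False by simp
  qed
qed

definition hadamard_product :: "('k::field, 'n::finite) proj_space set \<Rightarrow>
    ('k, 'n) proj_space set \<Rightarrow> ('k, 'n) proj_space set"  (infixl \<open>\<star>\<close> 70)
  where "X \<star> Y =
    zariski_closure {hadamard_point p q | p q. p \<in> X \<and> q \<in> Y \<and> hadamard_defined p q}"

definition binomial_of :: "'k::field \<Rightarrow> 'n monom \<Rightarrow> 'k \<Rightarrow> 'n monom \<Rightarrow> ('k, 'n) mpoly"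
  where "binomial_of a \<alpha> b \<beta> = Poly_Mapping.single \<alpha> a - Poly_Mapping.single \<beta> b"

definition is_binomial :: "('k::field, 'n) mpoly \<Rightarrow> bool"
  where "is_binomial f \<longleftrightarrow>
    (\<exists>a b \<alpha> \<beta>. a \<noteq> 0 \<and> b \<noteq> 0 \<and> \<alpha> \<noteq> \<beta> \<and> f = binomial_of a \<alpha> b \<beta>)"

definition binomial_variety :: "('k::field, 'n::finite) proj_space set \<Rightarrow> bool"
  where "binomial_variety V \<longleftrightarrow> zariski_closed V \<and>
    (\<exists>B. (\<forall>f\<in>B. is_binomial f \<and> homogeneous f) \<and> vanishing_ideal V = ideal_of B)"

text \<open>
  Lists of length \<open>s\<close> are functions on \<open>{..<s}\<close>; \<open>s = 0\<close>, where both ideals are zero, is allowed.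
\<close>

definition exhibits_same_exponents ::
    "('k::field, 'n::finite) proj_space set \<Rightarrow> ('k, 'n) proj_space set \<Rightarrow> nat \<Rightarrow>
     (nat \<Rightarrow> 'n monom) \<Rightarrow> (nat \<Rightarrow> 'n monom) \<Rightarrow>
     (nat \<Rightarrow> 'k) \<Rightarrow> (nat \<Rightarrow> 'k) \<Rightarrow> (nat \<Rightarrow> 'k) \<Rightarrow> (nat \<Rightarrow> 'k) \<Rightarrow> bool"
  where "exhibits_same_exponents V W s \<alpha> \<beta> a b c d \<longleftrightarrow>
    (\<forall>i<s. \<alpha> i \<noteq> \<beta> i) \<and>
    inj_on (\<lambda>i. (\<alpha> i, \<beta> i)) {..<s} \<and>
    (\<forall>i<s. a i \<noteq> 0 \<and> b i \<noteq> 0 \<and> c i \<noteq> 0 \<and> d i \<noteq> 0) \<and>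
    vanishing_ideal V = ideal_of ((\<lambda>i. binomial_of (a i) (\<alpha> i) (b i) (\<beta> i)) ` {..<s}) \<and>
    vanishing_ideal W = ideal_of ((\<lambda>i. binomial_of (c i) (\<alpha> i) (d i) (\<beta> i)) ` {..<s})"

definition same_binomial_exponents ::
    "('k::field, 'n::finite) proj_space set \<Rightarrow> ('k, 'n) proj_space set \<Rightarrow> bool"
  where "same_binomial_exponents V W \<longleftrightarrow>
    (\<exists>s \<alpha> \<beta> a b c d. exhibits_same_exponents V W s \<alpha> \<beta> a b c d)"

end

theory Submission
  imports Defs
begin

text \<open>
  Let \<open>p \<in> V\<close> have no zero coordinate. Since \<open>a\<^sub>i p\<^sup>\<alpha> = b\<^sub>i p\<^sup>\<beta>\<close> for every generator of the ideal of \<open>V\<close>,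
  the substitution \<open>x \<mapsto> p\<^sup>-\<^sup>1 x\<close> carries the generators of the ideal of \<open>W\<close>, up to units, to the
  binomials with coefficients \<open>a\<^sub>i c\<^sub>i\<close> and \<open>b\<^sub>i d\<^sub>i\<close>. So a form vanishing on \<open>p \<star> W\<close>, and a fortiori
  one vanishing on \<open>V \<star> W\<close>, lies in the ideal they generate. Conversely these binomials vanish on
  \<open>V \<star> W\<close> by multiplying the equations that hold on \<open>V\<close> and on \<open>W\<close>, and they are forms because
  scaling \<open>p\<close> by \<open>2\<close> preserves \<open>a\<^sub>i p\<^sup>\<alpha> = b\<^sub>i p\<^sup>\<beta>\<close> only if both exponents have the same degree.
\<close>

section \<open>Ideals as submodules\<close>

lemma ideal_of_base: "x \<in> B \<Longrightarrow> x \<in> ideal_of B"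
  unfolding ideal_of_def by (rule module.span_base[OF module_times])

lemma ideal_of_zero: "0 \<in> ideal_of B"
  unfolding ideal_of_def by (rule module.span_zero[OF module_times])

lemma ideal_of_add: "x \<in> ideal_of B \<Longrightarrow> y \<in> ideal_of B \<Longrightarrow> x + y \<in> ideal_of B"
  unfolding ideal_of_def by (rule module.span_add[OF module_times])

lemma ideal_of_times: "x \<in> ideal_of B \<Longrightarrow> r * x \<in> ideal_of B"
  unfolding ideal_of_def by (rule module.span_scale[OF module_times])

lemma ideal_of_induct [consumes 1, case_names zero step]:
  assumes "x \<in> ideal_of B" and "P 0" and "\<And>r b y. b \<in> B \<Longrightarrow> P y \<Longrightarrow> P (r * b + y)"
  shows "P x"
  by (rule module.span_induct_alt[OF module_times assms(1)[unfolded ideal_of_def]])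
    (use assms in auto)

lemma ideal_of_subset:
  assumes "B \<subseteq> ideal_of C"
  shows "ideal_of B \<subseteq> ideal_of C"
proof
  fix x assume "x \<in> ideal_of B"
  then show "x \<in> ideal_of C"
    by (induction rule: ideal_of_induct)
      (use assms in \<open>auto intro: ideal_of_zero ideal_of_add ideal_of_times\<close>)
qed

section \<open>Evaluation of monomials and polynomials at coordinate vectors\<close>

definition eval_monom :: "('n::finite \<Rightarrow> 'k::field) \<Rightarrow> 'n monom \<Rightarrow> 'k"
  where "eval_monom v m = (\<Prod>i\<in>UNIV. v i ^ Poly_Mapping.lookup m i)"

lemma eval_monom_add: "eval_monom v (m + n) = eval_monom v m * eval_monom v n"
  by (simp add: eval_monom_def lookup_add power_add prod.distrib)

lemma eval_monom_mult: "eval_monom (\<lambda>i. u i * v i) m = eval_monom u m * eval_monom v m"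
  by (simp add: eval_monom_def power_mult_distrib prod.distrib)

lemma eval_monom_scale: "eval_monom (\<lambda>i. c * v i) m = c ^ monom_degree m * eval_monom v m"
  by (simp add: eval_monom_def monom_degree_def power_mult_distrib prod.distrib power_sum)

lemma eval_monom_inverse: "eval_monom (\<lambda>i. inverse (u i)) m = inverse (eval_monom u m)"
  by (simp add: eval_monom_def power_inverse flip: prod_inversef)

lemma eval_monom_nonzero: "(\<And>i. v i \<noteq> 0) \<Longrightarrow> eval_monom v m \<noteq> 0"
  by (simp add: eval_monom_def)

text \<open>Exponents outside the support have coefficient zero, so polynomials with different
  supports can be evaluated over one common index set. Additivity of evaluation rests on
  this.\<close>

lemma eval_mpoly_superset:
  assumes "finite A" and "Poly_Mapping.keys f \<subseteq> A"
  shows "eval_mpoly f v = (\<Sum>m\<in>A. Poly_Mapping.lookup f m * eval_monom v m)"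
  unfolding eval_mpoly_def eval_monom_def
  by (rule sum.mono_neutral_left) (use assms in \<open>auto simp: in_keys_iff\<close>)

lemma eval_mpoly_zero: "eval_mpoly 0 v = 0"
  by (simp add: eval_mpoly_def)

lemma eval_mpoly_add: "eval_mpoly (f + g) v = eval_mpoly f v + eval_mpoly g v"
proof -
  let ?A = "Poly_Mapping.keys f \<union> Poly_Mapping.keys g"
  have "Poly_Mapping.keys (f + g) \<subseteq> ?A"
    by (rule Poly_Mapping.keys_add)
  then show ?thesis
    by (simp add: eval_mpoly_superset[of ?A] lookup_add distrib_right sum.distrib)
qed

lemma eval_mpoly_single: "eval_mpoly (Poly_Mapping.single m c) v = c * eval_monom v m"
  by (cases "c = 0") (auto simp: eval_mpoly_def eval_monom_def)

text \<open>A polynomial arises from zero, itself a single term with coefficient 0, by updates at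
  exponents outside the current support, and each such update is the addition of one term. Used
  twice in a row, the rule reduces multiplicativity of an additive map to products of two
  terms.\<close>

lemma mpoly_induct [case_names single add]:
  fixes f :: "('k::field, 'n) mpoly"
  assumes "\<And>m c. P (Poly_Mapping.single m c)" and "\<And>f g. P f \<Longrightarrow> P g \<Longrightarrow> P (f + g)"
  shows "P f"
proof (induction f rule: update_induct)
  case const
  then show ?case
    using assms(1)[of 0 0] by simp
next
  case (update f m c)
  have "Poly_Mapping.update m c f = f + Poly_Mapping.single m c"
    using update(1) by (intro poly_mapping_eqI)
      (auto simp: lookup_update lookup_add lookup_single when_def in_keys_iff)
  then show ?case
    using assms update by simp
qed

lemma eval_mpoly_mult: "eval_mpoly (f * g) v = eval_mpoly f v * eval_mpoly g v"
proof (induction f rule: mpoly_induct)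
  case (single m c)
  show ?case
    by (induction g rule: mpoly_induct)
      (simp_all add: mult_single eval_mpoly_single eval_monom_add distrib_left eval_mpoly_add)
qed (simp add: distrib_right eval_mpoly_add)

lemma eval_binomial_of:
  "eval_mpoly (binomial_of a \<alpha> b \<beta>) v = a * eval_monom v \<alpha> - b * eval_monom v \<beta>"
proof -
  have "binomial_of a \<alpha> b \<beta> = Poly_Mapping.single \<alpha> a + Poly_Mapping.single \<beta> (- b)"
    by (simp add: binomial_of_def single_uminus)
  then show ?thesis
    by (simp add: eval_mpoly_add eval_mpoly_single)
qed

lemma homogeneous_binomial_of:
  "monom_degree \<alpha> = monom_degree \<beta> \<Longrightarrow> homogeneous (binomial_of a \<alpha> b \<beta>)"
  unfolding homogeneous_def binomial_of_def
  by (rule exI[of _ "monom_degree \<alpha>"])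
    (auto dest!: subsetD[OF keys_diff] split: if_splits)

section \<open>The substitution that replaces each variable \<open>x_i\<close> by \<open>u i\<close>
  times \<open>x_i\<close>\<close>

definition scale_vars :: "('n::finite \<Rightarrow> 'k::field) \<Rightarrow> ('k, 'n) mpoly \<Rightarrow> ('k, 'n) mpoly"
  where "scale_vars u f = Poly_Mapping.mapp (\<lambda>m c. c * eval_monom u m) f"

lemma lookup_scale_vars:
  "Poly_Mapping.lookup (scale_vars u f) m = Poly_Mapping.lookup f m * eval_monom u m"
  by (simp add: scale_vars_def lookup_mapp when_def in_keys_iff)

lemma keys_scale_vars: "Poly_Mapping.keys (scale_vars u f) \<subseteq> Poly_Mapping.keys f"
  by (auto simp: in_keys_iff lookup_scale_vars)

lemma homogeneous_scale_vars: "homogeneous f \<Longrightarrow> homogeneous (scale_vars u f)"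
  using keys_scale_vars unfolding homogeneous_def by blast

lemma scale_vars_add: "scale_vars u (f + g) = scale_vars u f + scale_vars u g"
  by (rule poly_mapping_eqI) (simp add: lookup_scale_vars lookup_add distrib_right)

lemma scale_vars_single:
  "scale_vars u (Poly_Mapping.single m c) = Poly_Mapping.single m (c * eval_monom u m)"
  by (rule poly_mapping_eqI) (simp add: lookup_scale_vars lookup_single when_def)

text \<open>The factor \<open>eval_monom u m\<close> turns sums of exponents into products, so
  rescaling the coefficients by it respects the product of two terms, and by additivity every
  product.\<close>

lemma scale_vars_mult: "scale_vars u (f * g) = scale_vars u f * scale_vars u g"
proof (induction f rule: mpoly_induct)
  case (single m c)
  show ?case
  proof (induction g rule: mpoly_induct)
    case (single m c)
    show ?case
      by (simp add: mult_single scale_vars_single eval_monom_add mult_ac)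
  qed (simp add: distrib_left scale_vars_add)
qed (simp add: distrib_right scale_vars_add)

lemma scale_vars_binomial_of:
  "scale_vars u (binomial_of a \<alpha> b \<beta>) =
    binomial_of (a * eval_monom u \<alpha>) \<alpha> (b * eval_monom u \<beta>) \<beta>"
  by (rule poly_mapping_eqI)
    (simp add: lookup_scale_vars binomial_of_def lookup_minus lookup_single when_def left_diff_distrib)

lemma scale_vars_inverse:
  assumes "\<And>i. u i \<noteq> 0"
  shows "scale_vars (\<lambda>i. inverse (u i)) (scale_vars u f) = f"
  by (rule poly_mapping_eqI)
    (simp add: lookup_scale_vars eval_monom_inverse eval_monom_nonzero assms)

lemma eval_scale_vars: "eval_mpoly (scale_vars u f) v = eval_mpoly f (\<lambda>i. u i * v i)"
  by (induction f rule: mpoly_induct)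
    (simp_all add: scale_vars_single scale_vars_add eval_mpoly_single eval_mpoly_add
      eval_monom_mult mult_ac)

text \<open>A ring homomorphism carries a combination of elements of \<open>B\<close> to a
  combination of their images.\<close>

lemma scale_vars_ideal_of:
  assumes "f \<in> ideal_of B"
  shows "scale_vars u f \<in> ideal_of (scale_vars u ` B)"
  using assms
proof (induction rule: ideal_of_induct)
  case zero
  have "scale_vars u 0 = 0"
    by (rule poly_mapping_eqI) (simp add: lookup_scale_vars)
  then show ?case
    by (simp add: ideal_of_zero)
next
  case (step r b y)
  then show ?case
    by (simp add: scale_vars_add scale_vars_mult ideal_of_add ideal_of_times ideal_of_base)
qed

section \<open>Coordinates of points and of Hadamard products\<close>

lemma eval_vanishing_ideal:
  assumes "f \<in> vanishing_ideal X" and "p \<in> X" and "v \<in> homogeneous_coords p"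
  shows "eval_mpoly f v = 0"
  \<comment> \<open>The generating forms vanish at every coordinate vector of the point, and
    evaluation is a ring homomorphism; hence inhomogeneous members of the ideal vanish there
    too.\<close>
  using assms(1) unfolding vanishing_ideal_def
  by (induction rule: ideal_of_induct)
    (use assms(2,3) in \<open>auto simp: eval_mpoly_zero eval_mpoly_add eval_mpoly_mult vanishes_at_def\<close>)

lemma homogeneous_coords_nonempty: "\<exists>v. v \<in> homogeneous_coords p"
  by transfer blast

lemma homogeneous_coords_scale:
  "v \<in> homogeneous_coords p \<Longrightarrow> c \<noteq> 0 \<Longrightarrow> (\<lambda>i. c * v i) \<in> homogeneous_coords p"
proof (transfer, goal_cases)
  case (1 v p c)
  have "proj_rel v (\<lambda>i. c * v i)"
    using 1 proj_rel_sym[of p v] unfolding proj_rel_def by blast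
  then show ?case
    using 1 proj_rel_trans[of p v] by simp
qed

lemma all_coords_nonzeroD:
  "all_coords_nonzero p \<Longrightarrow> v \<in> homogeneous_coords p \<Longrightarrow> v i \<noteq> 0"
  by transfer (auto simp: proj_rel_def)

lemma homogeneous_coords_hadamard:
  assumes "hadamard_defined p q" and "u \<in> homogeneous_coords p" and "v \<in> homogeneous_coords q"
  shows "(\<lambda>i. u i * v i) \<in> homogeneous_coords (hadamard_point p q)"
  using assms
proof (transfer, goal_cases)
  case (1 p q u v)
  then obtain c d where "c \<noteq> 0" "u = (\<lambda>i. c * p i)" "d \<noteq> 0" "v = (\<lambda>i. d * q i)"
    unfolding proj_rel_def by blast
  with 1(3) show ?case
    by (auto simp: proj_rel_def intro!: exI[of _ "c * d"])
qed

text \<open>A coordinate vector of the product is a nonzero scalar times the product of two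
  representatives; the scalar is absorbed into the first factor.\<close>

lemma homogeneous_coords_hadamardE:
  assumes "hadamard_defined p q" and "w \<in> homogeneous_coords (hadamard_point p q)"
  obtains u v where "u \<in> homogeneous_coords p" and "v \<in> homogeneous_coords q"
    and "w = (\<lambda>i. u i * v i)"
proof -
  have "\<exists>u v. u \<in> homogeneous_coords p \<and> v \<in> homogeneous_coords q \<and> w = (\<lambda>i. u i * v i)"
    using assms
  proof (transfer, goal_cases)
    case (1 p q w)
    then obtain c where c: "c \<noteq> 0" "w = (\<lambda>i. c * (p i * q i))"
      unfolding proj_rel_def by auto
    have "proj_rel p (\<lambda>i. c * p i)"
      using 1(1) c(1) unfolding proj_rel_def by blast
    moreover have "w = (\<lambda>i. (c * p i) * q i)"
      using c(2) by (simp add: mult.assoc)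
    ultimately show ?case
      using 1(2) by blast
  qed
  then show thesis
    using that by blast
qed

text \<open>Some coordinate of \<open>q\<close> is nonzero, and multiplying it by the nonzero
  coordinate of \<open>p\<close> at that index keeps it nonzero.\<close>

lemma hadamard_defined_nonzero:
  assumes "all_coords_nonzero p"
  shows "hadamard_defined p q"
proof -
  obtain v where "v \<in> homogeneous_coords q"
    using homogeneous_coords_nonempty by blast
  with assms show ?thesis
  proof (transfer, goal_cases)
    case (1 p v q)
    then have "\<exists>i. q i \<noteq> 0"
      unfolding proj_rel_def by blast
    with 1 show ?case
      by simp
  qed
qed

lemma hadamard_product_commute: "X \<star> Y = Y \<star> X"
proof -
  have "hadamard_defined p q = hadamard_defined q p" for p q :: "('a, 'b) proj_space"
    by transfer (simp add: mult.commute)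
  moreover have "hadamard_point p q = hadamard_point q p" for p q :: "('a, 'b) proj_space"
  proof (transfer, goal_cases)
    case (1 p q)
    \<comment> \<open>The all-ones vector is the default value of \<open>hadamard_point\<close> when
      the product is undefined. It must be shown to be related to itself, since
      \<open>proj_rel\<close> is only a partial equivalence.\<close>
    have "proj_rel (\<lambda>_ :: 'b. 1 :: 'a) (\<lambda>_. 1)"
      by (rule proj_rel_refl) simp
    then show ?case
      using proj_rel_refl[of "\<lambda>i. p i * q i"]
      by (simp only: mult.commute[of "q _"]) (simp split: if_split)
  qed
  ultimately show ?thesis
    unfolding hadamard_product_def by (metis (no_types, lifting))
qed

section \<open>Zariski closure\<close>

lemma subset_zariski_closure: "X \<subseteq> zariski_closure X"
  by (auto simp: zariski_closure_def)

text \<open>The closure is the zero set of all forms vanishing on \<open>X\<close>: that set is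
  closed and contains \<open>X\<close>, and the forms cutting out any other closed superset of
  \<open>X\<close> are among these.\<close>

lemma zariski_closed_closure: "zariski_closed (zariski_closure X)"
  unfolding zariski_closed_def
proof (intro exI conjI)
  let ?F = "{f. homogeneous f \<and> (\<forall>p\<in>X. vanishes_at f p)}"
  show "\<forall>f\<in>?F. homogeneous f"
    by simp
  show "zariski_closure X = {p. \<forall>f\<in>?F. vanishes_at f p}"
  proof
    have "zariski_closed {p. \<forall>f\<in>?F. vanishes_at f p}"
      unfolding zariski_closed_def by (intro exI[of _ ?F]) simp
    then show "zariski_closure X \<subseteq> {p. \<forall>f\<in>?F. vanishes_at f p}"
      unfolding zariski_closure_def by (intro Inter_lower) auto
    show "{p. \<forall>f\<in>?F. vanishes_at f p} \<subseteq> zariski_closure X"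
      unfolding zariski_closure_def zariski_closed_def by blast
  qed
qed

text \<open>The zero set of a single form is closed, so it contains the closure as soon as it
  contains \<open>X\<close>.\<close>

lemma vanishes_at_closure:
  assumes "homogeneous f" and "\<And>p. p \<in> X \<Longrightarrow> vanishes_at f p" and "p \<in> zariski_closure X"
  shows "vanishes_at f p"
proof -
  have "zariski_closed {p. vanishes_at f p}"
    unfolding zariski_closed_def by (intro exI[of _ "{f}"]) (simp add: assms(1))
  then have "zariski_closure X \<subseteq> {p. vanishes_at f p}"
    unfolding zariski_closure_def by (intro Inter_lower) (auto intro: assms(2))
  then show ?thesis
    using assms(3) by auto
qed

section \<open>Binomials vanishing at a point without zero coordinates\<close>

lemma binomial_vanishing_imp_homogeneous:
  fixes a b :: "'k::field_char_0"
  assumes "binomial_of a \<alpha> b \<beta> \<in> vanishing_ideal X" and "a \<noteq> 0"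
    and "p \<in> X" and "all_coords_nonzero p"
  shows "monom_degree \<alpha> = monom_degree \<beta>"
proof -
  obtain u where u: "u \<in> homogeneous_coords p"
    using homogeneous_coords_nonempty by blast
  have nz: "eval_monom u \<alpha> \<noteq> 0"
    by (intro eval_monom_nonzero all_coords_nonzeroD[OF assms(4) u])
  have 1: "a * eval_monom u \<alpha> = b * eval_monom u \<beta>"
    using eval_vanishing_ideal[OF assms(1,3) u] by (simp add: eval_binomial_of)
  have "(\<lambda>i. 2 * u i) \<in> homogeneous_coords p"
    by (rule homogeneous_coords_scale[OF u]) simp
  from eval_vanishing_ideal[OF assms(1,3) this]
  have "2 ^ monom_degree \<alpha> * (a * eval_monom u \<alpha>) = 2 ^ monom_degree \<beta> * (b * eval_monom u \<beta>)"
    by (simp add: eval_binomial_of eval_monom_scale mult.left_commute)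
  \<comment> \<open>By the equation at \<open>u\<close> itself, both sides contain the same nonzero
    factor, which cancels.\<close>
  then have "(2 :: 'k) ^ monom_degree \<alpha> = 2 ^ monom_degree \<beta>"
    using nz assms(2) by (simp flip: 1)
  \<comment> \<open>Characteristic zero lets the equation be read in the natural numbers, where
    distinct powers of 2 differ.\<close>
  then have "of_nat (2 ^ monom_degree \<alpha>) = (of_nat (2 ^ monom_degree \<beta>) :: 'k)"
    by simp
  then show ?thesis
    by (simp only: of_nat_eq_iff) simp
qed

lemma exhibits_same_exponents_commute:
  "exhibits_same_exponents V W s \<alpha> \<beta> a b c d \<Longrightarrow> exhibits_same_exponents W V s \<alpha> \<beta> c d a b"
  by (auto simp: exhibits_same_exponents_def)

lemma exhibits_binomial_in_ideal:
  assumes "exhibits_same_exponents V W s \<alpha> \<beta> a b c d" and "i < s"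
  shows "binomial_of (a i) (\<alpha> i) (b i) (\<beta> i) \<in> vanishing_ideal V"
    and "binomial_of (c i) (\<alpha> i) (d i) (\<beta> i) \<in> vanishing_ideal W"
  using assms by (auto simp: exhibits_same_exponents_def intro: ideal_of_base)

lemma exhibits_homogeneous:
  fixes V W :: "('k::field_char_0, 'n::finite) proj_space set"
  assumes "exhibits_same_exponents V W s \<alpha> \<beta> a b c d" and "i < s"
    and "p \<in> V" and "all_coords_nonzero p"
  shows "monom_degree (\<alpha> i) = monom_degree (\<beta> i)"
  by (rule binomial_vanishing_imp_homogeneous[OF exhibits_binomial_in_ideal(1)[OF assms(1,2)]])
    (use assms in \<open>auto simp: exhibits_same_exponents_def\<close>)

section \<open>The vanishing ideal of a Hadamard product\<close>

lemma vanishing_ideal_hadamard_product: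
  fixes V W :: "('k::field_char_0, 'n::finite) proj_space set"
  assumes ex: "exhibits_same_exponents V W s \<alpha> \<beta> a b c d"
    and p: "p \<in> V" "all_coords_nonzero p"
  shows "vanishing_ideal (V \<star> W) =
    ideal_of ((\<lambda>i. binomial_of (a i * c i) (\<alpha> i) (b i * d i) (\<beta> i)) ` {..<s})"
    (is "_ = ideal_of (?g ` _)")
proof
  obtain u where u: "u \<in> homogeneous_coords p"
    using homogeneous_coords_nonempty by blast
  note u0 = all_coords_nonzeroD[OF p(2) u]
  define u' where "u' = (\<lambda>i. inverse (u i))"
  show "vanishing_ideal (V \<star> W) \<subseteq> ideal_of (?g ` {..<s})"
    unfolding vanishing_ideal_def
  proof (rule ideal_of_subset, safe)
    fix f assume hom: "homogeneous f" and van: "\<forall>p\<in>V \<star> W. vanishes_at f p"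
    \<comment> \<open>The value of the rescaled form at \<open>v\<close> is the value of
      \<open>f\<close> at the coordinatewise product of \<open>u\<close> and \<open>v\<close>, which
      represents a point of \<open>V \<star> W\<close>.\<close>
    have "vanishes_at (scale_vars u f) q" if "q \<in> W" for q
      unfolding vanishes_at_def
    proof
      fix v assume v: "v \<in> homogeneous_coords q"
      have def: "hadamard_defined p q"
        by (rule hadamard_defined_nonzero[OF p(2)])
      have "hadamard_point p q \<in> V \<star> W"
        unfolding hadamard_product_def
        using p(1) that def by (intro subsetD[OF subset_zariski_closure]) blast
      then have "vanishes_at f (hadamard_point p q)"
        using van by blast
      then show "eval_mpoly (scale_vars u f) v = 0"
        using homogeneous_coords_hadamard[OF def u v] by (simp add: eval_scale_vars vanishes_at_def)
    qed
    then have "scale_vars u f \<in> vanishing_ideal W"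
      unfolding vanishing_ideal_def using homogeneous_scale_vars[OF hom] by (intro ideal_of_base) simp
    then have "scale_vars u f \<in> ideal_of ((\<lambda>i. binomial_of (c i) (\<alpha> i) (d i) (\<beta> i)) ` {..<s})"
      using ex by (simp add: exhibits_same_exponents_def)
    \<comment> \<open>Rescaling by the inverse coordinates recovers \<open>f\<close> and moves the
      generators of the ideal of \<open>W\<close> along.\<close>
    from scale_vars_ideal_of[OF this, of u']
    have "f \<in> ideal_of (scale_vars u' ` (\<lambda>i. binomial_of (c i) (\<alpha> i) (d i) (\<beta> i)) ` {..<s})"
      unfolding u'_def by (simp add: scale_vars_inverse u0)
    also have "\<dots> \<subseteq> ideal_of (?g ` {..<s})"
    proof (rule ideal_of_subset, safe)
      fix i assume i: "i < s"
      \<comment> \<open>The inverse of the common value of the two terms of the \<open>i\<close>-th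
        binomial of \<open>V\<close> at \<open>u\<close>. Thus \<open>r * a i\<close> and
        \<open>r * b i\<close> invert the two monomials at \<open>u\<close>, so the rescaled
        generator is \<open>r\<close> times the wanted binomial;
        \<open>Poly_Mapping.single 0 r\<close> is the constant \<open>r\<close>.\<close>
      define r where "r = inverse (a i * eval_monom u (\<alpha> i))"
      have nz: "a i \<noteq> 0" "b i \<noteq> 0" "eval_monom u (\<alpha> i) \<noteq> 0" "eval_monom u (\<beta> i) \<noteq> 0"
        using ex i by (auto simp: exhibits_same_exponents_def eval_monom_nonzero u0)
      have eq: "a i * eval_monom u (\<alpha> i) = b i * eval_monom u (\<beta> i)"
        using eval_vanishing_ideal[OF exhibits_binomial_in_ideal(1)[OF ex i] p(1) u]
        by (simp add: eval_binomial_of)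
      have "c i * eval_monom u' (\<alpha> i) = r * (a i * c i)"
        using nz by (simp add: r_def u'_def eval_monom_inverse)
      moreover have "d i * eval_monom u' (\<beta> i) = r * (b i * d i)"
        using nz by (simp add: r_def eq u'_def eval_monom_inverse)
      ultimately have "scale_vars u' (binomial_of (c i) (\<alpha> i) (d i) (\<beta> i)) =
          Poly_Mapping.single 0 r * ?g i"
        by (simp only: scale_vars_binomial_of) (simp add: binomial_of_def right_diff_distrib mult_single)
      then show "scale_vars u' (binomial_of (c i) (\<alpha> i) (d i) (\<beta> i)) \<in> ideal_of (?g ` {..<s})"
        using i by (auto intro: ideal_of_times ideal_of_base)
    qed
    finally show "f \<in> ideal_of (?g ` {..<s})" .
  qed
  show "ideal_of (?g ` {..<s}) \<subseteq> vanishing_ideal (V \<star> W)"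
    unfolding vanishing_ideal_def
  proof (rule ideal_of_subset, safe)
    fix i assume i: "i < s"
    \<comment> \<open>Needed twice: the vanishing ideal is generated by forms only, and vanishing
      passes to the closure for forms.\<close>
    have hom: "homogeneous (?g i)"
      by (rule homogeneous_binomial_of[OF exhibits_homogeneous[OF ex i p]])
    have "vanishes_at (?g i) x" if "x \<in> V \<star> W" for x
    proof (rule vanishes_at_closure[OF hom _ that[unfolded hadamard_product_def]], clarify)
      fix q r assume qr: "q \<in> V" "r \<in> W" "hadamard_defined q r"
      show "vanishes_at (?g i) (hadamard_point q r)"
        unfolding vanishes_at_def
      proof
        fix w assume "w \<in> homogeneous_coords (hadamard_point q r)"
        then obtain v v' where v: "v \<in> homogeneous_coords q" "v' \<in> homogeneous_coords r"
          and w: "w = (\<lambda>i. v i * v' i)"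
          using homogeneous_coords_hadamardE[OF qr(3)] by blast
        have "a i * eval_monom v (\<alpha> i) = b i * eval_monom v (\<beta> i)"
          using eval_vanishing_ideal[OF exhibits_binomial_in_ideal(1)[OF ex i] qr(1) v(1)]
          by (simp add: eval_binomial_of)
        moreover have "c i * eval_monom v' (\<alpha> i) = d i * eval_monom v' (\<beta> i)"
          using eval_vanishing_ideal[OF exhibits_binomial_in_ideal(2)[OF ex i] qr(2) v(2)]
          by (simp add: eval_binomial_of)
        ultimately have "(a i * eval_monom v (\<alpha> i)) * (c i * eval_monom v' (\<alpha> i)) =
            (b i * eval_monom v (\<beta> i)) * (d i * eval_monom v' (\<beta> i))"
          by simp
        then show "eval_mpoly (?g i) w = 0"
          by (simp add: w eval_binomial_of eval_monom_mult mult_ac)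
      qed
    qed
    with hom show "?g i \<in> ideal_of {f. homogeneous f \<and> (\<forall>p\<in>V \<star> W. vanishes_at f p)}"
      by (intro ideal_of_base) blast
  qed
qed

theorem theorem3p5:
  fixes V W :: "('k::{alg_closed_field, field_char_0}, 'n::finite) proj_space set"
  assumes "binomial_variety V" and "binomial_variety W"
    and "same_binomial_exponents V W"
    and "(\<exists>p\<in>V. all_coords_nonzero p) \<or> (\<exists>p\<in>W. all_coords_nonzero p)"
  shows "binomial_variety (V \<star> W) \<and>
    same_binomial_exponents (V \<star> W) V \<and>
    same_binomial_exponents (V \<star> W) W \<and>
    (\<forall>s \<alpha> \<beta> a b c d. exhibits_same_exponents V W s \<alpha> \<beta> a b c d \<longrightarrow>
      vanishing_ideal (V \<star> W) =
        ideal_of ((\<lambda>i. binomial_of (a i * c i) (\<alpha> i) (b i * d i) (\<beta> i)) ` {..<s}))"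
proof -
  \<comment> \<open>Stated for arbitrary exhibiting data, because the explicit formula is claimed
    for all of them; the remaining claims use a single choice.\<close>
  have ideal: "vanishing_ideal (V \<star> W) =
      ideal_of ((\<lambda>i. binomial_of (a i * c i) (\<alpha> i) (b i * d i) (\<beta> i)) ` {..<s})"
    and deg: "\<forall>i<s. monom_degree (\<alpha> i) = monom_degree (\<beta> i)"
    if ex: "exhibits_same_exponents V W s \<alpha> \<beta> a b c d" for s \<alpha> \<beta> a b c d
  proof -
    note ex' = exhibits_same_exponents_commute[OF ex]
    show "vanishing_ideal (V \<star> W) =
      ideal_of ((\<lambda>i. binomial_of (a i * c i) (\<alpha> i) (b i * d i) (\<beta> i)) ` {..<s})"
      using assms(4)
    proof
      \<comment> \<open>Exchanging \<open>V\<close> and \<open>W\<close> puts the point into the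
        first variety; commutativity of the Hadamard product and of the coefficients undoes the
        exchange.\<close>
      assume "\<exists>p\<in>W. all_coords_nonzero p"
      then show ?thesis
        using vanishing_ideal_hadamard_product[OF ex']
        by (auto simp: hadamard_product_commute[of V W] mult.commute)
    qed (use vanishing_ideal_hadamard_product[OF ex] in blast)
    show "\<forall>i<s. monom_degree (\<alpha> i) = monom_degree (\<beta> i)"
      using assms(4) exhibits_homogeneous[OF ex] exhibits_homogeneous[OF ex'] by blast
  qed
  obtain s \<alpha> \<beta> a b c d where ex: "exhibits_same_exponents V W s \<alpha> \<beta> a b c d"
    using assms(3) unfolding same_binomial_exponents_def by blast
  \<comment> \<open>The exponents are unchanged, and products of nonzero coefficients are
    nonzero.\<close>
  have "exhibits_same_exponents (V \<star> W) V s \<alpha> \<beta> (\<lambda>i. a i * c i) (\<lambda>i. b i * d i) a b"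
    "exhibits_same_exponents (V \<star> W) W s \<alpha> \<beta> (\<lambda>i. a i * c i) (\<lambda>i. b i * d i) c d"
    using ex ideal[OF ex] by (simp_all add: exhibits_same_exponents_def)
  moreover have "binomial_variety (V \<star> W)"
    unfolding binomial_variety_def
  proof (intro conjI exI)
    show "zariski_closed (V \<star> W)"
      unfolding hadamard_product_def by (rule zariski_closed_closure)
    have "is_binomial (binomial_of (a i * c i) (\<alpha> i) (b i * d i) (\<beta> i))" if "i < s" for i
    proof -
      have "a i * c i \<noteq> 0" "b i * d i \<noteq> 0" "\<alpha> i \<noteq> \<beta> i"
        using ex that by (auto simp: exhibits_same_exponents_def)
      then show ?thesis
        unfolding is_binomial_def by blast
    qed
    then show "\<forall>f\<in>(\<lambda>i. binomial_of (a i * c i) (\<alpha> i) (b i * d i) (\<beta> i)) ` {..<s}.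
        is_binomial f \<and> homogeneous f"
      using deg[OF ex] by (auto intro: homogeneous_binomial_of)
  qed (rule ideal[OF ex])
  ultimately show ?thesis
    unfolding same_binomial_exponents_def using ideal by blast
qed

end
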